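(* Let $q \geq 150$ be an integer, let $\chi$ be a primitive Dirichlet character modulo $q$, and put $N = 4\log q$. Then for every complex number $s$ with $|s-1| \leq e^{-1}$, $$\left| L(s,\chi) - \sum_{0 \leq n \leq N} \frac{(-1)^n \gamma_n(\chi)}{n!}(s-1)^n \right| \leq \frac{32.3}{q^{2.5}},$$ where the sum runs over integers $n$ with $0\le n\le N$.
   Context: $L(s,\chi)$ denotes the Dirichlet $L$-function attached to $\chi$ (analytically continued). The Laurent-Stieltjes constants $\gamma_n(\chi)$, $n \geq 0$, of a primitive Dirichlet character $\chi$ are defined by the Laurent expansion around $s=1$ $$L(s,\chi) = \frac{\delta_\chi}{s-1} + \sum_{n \geq 0} \frac{(-1)^n \gamma_n(\chi)}{n!}(s-1)^n,$$ where $\delta_\chi = 1$ if $\chi$ is principal and $\delta_\chi = 0$ otherwise. In particular, when $\chi$ is non-principal, $(-1)^n \gamma_n(\chi)$ is the value $L^{(n)}(1,\chi)$ of the $n$-th derivative of $L(s,\chi)$ at $s=1$. Here $\log$ is the natural logarithm; $N$ need not be an integer. *)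

theory Defs
  imports "HOL-Complex_Analysis.Complex_Analysis"
begin

definition dirichlet_character :: "nat \<Rightarrow> (int \<Rightarrow> complex) \<Rightarrow> bool" where
  "dirichlet_character q chi \<longleftrightarrow>
     q > 0 \<and>
     (\<forall>m n. chi (m * n) = chi m * chi n) \<and>
     (\<forall>n. chi (n + int q) = chi n) \<and>
     (\<forall>n. chi n = 0 \<longleftrightarrow> \<not> coprime n (int q))"

definition principal_character :: "nat \<Rightarrow> (int \<Rightarrow> complex) \<Rightarrow> bool" where
  "principal_character q chi \<longleftrightarrow>
     dirichlet_character q chi \<and> (\<forall>n. coprime n (int q) \<longrightarrow> chi n = 1)"

definition induced_by :: "nat \<Rightarrow> (int \<Rightarrow> complex) \<Rightarrow> nat \<Rightarrow> (int \<Rightarrow> complex) \<Rightarrow> bool" where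
  "induced_by q chi d \<psi> \<longleftrightarrow>
     d dvd q \<and> dirichlet_character d \<psi> \<and> (\<forall>n. coprime n (int q) \<longrightarrow> chi n = \<psi> n)"

definition primitive_character :: "nat \<Rightarrow> (int \<Rightarrow> complex) \<Rightarrow> bool" where
  "primitive_character q chi \<longleftrightarrow>
     dirichlet_character q chi \<and> \<not> (\<exists>d \<psi>. d < q \<and> induced_by q chi d \<psi>)"

(* The analytic continuation of the Dirichlet series. It is entire for non-principal
   characters; for principal ones it has a pole at 1, where we fix the value 0.
   The function is unique by the identity theorem. *)
definition dirichlet_L :: "nat \<Rightarrow> (int \<Rightarrow> complex) \<Rightarrow> complex \<Rightarrow> complex" where
  "dirichlet_L q chi = (THE L.
     L holomorphic_on (if principal_character q chi then - {1} else UNIV) \<and>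
     (principal_character q chi \<longrightarrow> L 1 = 0) \<and>
     (\<forall>s. Re s > 1 \<longrightarrow>
        (\<lambda>n. chi (int (Suc n)) / of_nat (Suc n) powr s) sums L s))"

(* The coefficient of (s - 1)^n in the Laurent expansion of L(s, chi) at s = 1
   is (-1)^n gamma_n(chi) / n!. *)
definition laurent_stieltjes :: "nat \<Rightarrow> (int \<Rightarrow> complex) \<Rightarrow> nat \<Rightarrow> complex" where
  "laurent_stieltjes q chi n =
     (-1) ^ n * fact n * fls_nth (laurent_expansion (dirichlet_L q chi) 1) (int n)"

end

theory Submission
  imports Defs
begin

text \<open>Partial sums of a non-principal character are at most \<open>q\<close> in modulus, so summation by parts
  gives \<open>\<bar>L(s, \<chi>)\<bar> \<le> q (1 + 2 \<bar>s\<bar> / Re s)\<close> for \<open>Re s > 0\<close>; no functional equation is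
  needed. On the circle of radius \<open>R = exp (- 1 / 8)\<close> about 1 this is at most \<open>11 q / 2\<close>. By Cauchy's
  inequality the Taylor tail beyond \<open>N\<close> is then at most a constant times
  \<open>q (exp (- 1) / R)\<^sup>N = q exp (- 7 N / 8)\<close>, and \<open>N = 4 log q\<close> turns this into a multiple of
  \<open>q powr (- 5 / 2)\<close>. The entire continuation itself comes from summing by parts \<open>K\<close> times, with
  constants of summation that keep all sequences of mean zero: the resulting series converges for
  \<open>Re s > 1 - K\<close>.\<close>

section \<open>Finite differences of powers\<close>

text \<open>The value minus its successor, the sign that summation by parts produces; so this is
  (-1)^K times the K-th forward difference of \<open>z powr (- s)\<close>.\<close>

fun powr_diff :: "nat \<Rightarrow> complex \<Rightarrow> complex \<Rightarrow> complex" where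
  "powr_diff 0 s z = z powr (- s)"
| "powr_diff (Suc K) s z = powr_diff K s z - powr_diff K s (z + 1)"

text \<open>Differentiation in \<open>z\<close> commutes with differencing, so only the exponent
  moves, from \<open>s\<close> to \<open>s + 1\<close>.\<close>

lemma powr_diff_has_field_derivative:
  assumes "Re z > 0"
  shows "(powr_diff K s has_field_derivative - s * powr_diff K (s + 1) z) (at z)"
  using assms
proof (induction K arbitrary: z)
  case 0
  then have "z \<notin> \<real>\<^sub>\<le>\<^sub>0"
    by (auto simp: complex_nonpos_Reals_iff)
  then have "((\<lambda>z. z powr (- s)) has_field_derivative - s * z powr (- s - 1)) (at z)"
    by (rule has_field_derivative_powr)
  moreover have "- s - 1 = - (s + 1)"
    by simp
  ultimately show ?case
    by (simp only: powr_diff.simps)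
next
  case (Suc K)
  have "Re (z + 1) > 0"
    using Suc.prems by simp
  from Suc.IH[OF this] have "((\<lambda>z. powr_diff K s (z + 1)) has_field_derivative
      - s * powr_diff K (s + 1) (z + 1)) (at z)"
    by (rule DERIV_shift[THEN iffD1])
  from DERIV_diff[OF Suc.IH[OF Suc.prems] this] show ?case
    by (simp add: algebra_simps)
qed

text \<open>Mean value inequality on the segment from \<open>x\<close> to \<open>x + 1\<close>: each
  difference costs one derivative, which contributes a factor \<open>s\<close> and shifts
  \<open>s\<close> to \<open>s + 1\<close>. The sign of \<open>Re s + real K\<close> makes the power
  nonincreasing, so its maximum sits at the left end.\<close>

lemma norm_powr_diff_le:
  assumes "x > 0" "Re s + real K \<ge> 0"
  shows "norm (powr_diff K s (of_real x)) \<le> (\<Prod>j<K. norm (s + of_nat j)) * x powr (- Re s - real K)"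
  using assms
proof (induction K arbitrary: x s)
  case 0
  then show ?case
    by (simp add: norm_powr_real_powr)
next
  case (Suc K)
  let ?P = "\<Prod>j<Suc K. norm (s + of_nat j)"
  let ?S = "of_real ` {x..x + 1} :: complex set"
  have bound: "norm (- s * powr_diff K (s + 1) z) \<le> ?P * x powr (- Re s - real (Suc K))"
    if z: "z \<in> ?S" for z
  proof -
    obtain t where t: "z = of_real t" "x \<le> t"
      using z by auto
    have "norm (powr_diff K (s + 1) z)
        \<le> (\<Prod>j<K. norm (s + 1 + of_nat j)) * t powr (- Re s - real (Suc K))"
    proof -
      have "- Re (s + 1) - real K = - Re s - real (Suc K)"
        by simp
      then show ?thesis
        using Suc.IH[of t "s + 1"] Suc.prems t by (simp only:)
    qed
    also have "\<dots> \<le> (\<Prod>j<K. norm (s + 1 + of_nat j)) * x powr (- Re s - real (Suc K))"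
      using Suc.prems t by (intro mult_left_mono powr_mono2' prod_nonneg) auto
    finally have "norm (- s * powr_diff K (s + 1) z)
        \<le> norm s * ((\<Prod>j<K. norm (s + 1 + of_nat j)) * x powr (- Re s - real (Suc K)))"
      by (simp add: norm_mult mult_left_mono)
    also have "\<dots> = ?P * x powr (- Re s - real (Suc K))"
      by (subst prod.lessThan_Suc_shift) (simp add: algebra_simps)
    finally show ?thesis .
  qed
  have convex: "convex ?S"
    by (rule convex_linear_image[OF bounded_linear.linear[OF bounded_linear_of_real]]) simp
  have deriv: "(powr_diff K s has_field_derivative - s * powr_diff K (s + 1) z) (at z within ?S)"
    if "z \<in> ?S" for z
  proof -
    have "Re z > 0"
      using that Suc.prems by auto
    from has_field_derivative_at_within[OF powr_diff_has_field_derivative[OF this]]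
    show ?thesis .
  qed
  have "norm (powr_diff K s (of_real x) - powr_diff K s (of_real (x + 1)))
      \<le> ?P * x powr (- Re s - real (Suc K)) * norm (of_real x - of_real (x + 1) :: complex)"
    by (rule field_differentiable_bound[OF convex deriv bound]) (auto intro!: imageI simp del: of_real_add)
  moreover have "norm (of_real x - of_real (x + 1) :: complex) = 1"
    by simp
  ultimately show ?case
    by (simp only: powr_diff.simps of_real_add of_real_1 mult_1_right)
qed

lemma powr_diff_holomorphic:
  assumes "Re z > 0"
  shows "(\<lambda>s. powr_diff K s z) holomorphic_on A"
  using assms
proof (induction K arbitrary: z)
  case 0
  then show ?case
    by (auto intro!: holomorphic_intros)
next
  case (Suc K)
  then show ?case
    by (auto intro!: holomorphic_intros)
qed

text \<open>The majorant is kept as a difference so that it telescopes when summed over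
  integers.\<close>

lemma norm_powr_diff_one_le:
  assumes "Re s > 0" "x > 0"
  shows "norm (powr_diff 1 s (of_real x))
    \<le> norm s / Re s * (x powr (- Re s) - (x + 1) powr (- Re s))"
proof -
  let ?f = "\<lambda>t. powr_diff 0 s (of_real t)"
  \<comment> \<open>An antiderivative of \<open>norm s * t powr (- Re s - 1)\<close>, which is the
    norm of the derivative of \<open>?f\<close>.\<close>
  let ?phi = "\<lambda>t. - (norm s / Re s) * t powr (- Re s)"
  have "norm (?f (x + 1) - ?f x) \<le> ?phi (x + 1) - ?phi x"
  proof (rule differentiable_bound_general)
    have f': "(?f has_vector_derivative - s * powr_diff 0 (s + 1) (of_real t)) (at t)"
      if "t > 0" for t
      using that
      by (intro has_vector_derivative_real_field powr_diff_has_field_derivative) auto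
    have phi': "(?phi has_vector_derivative norm s * t powr (- Re s - 1)) (at t)" if "t > 0" for t
      unfolding has_real_derivative_iff_has_vector_derivative[symmetric]
      using that assms by (auto intro!: derivative_eq_intros simp: field_simps powr_diff)
    show "(?f has_vector_derivative - s * powr_diff 0 (s + 1) (of_real t)) (at t)" if "x < t" for t
      using that assms by (intro f') auto
    show "(?phi has_vector_derivative norm s * t powr (- Re s - 1)) (at t)" if "x < t" for t
      using that assms by (intro phi') auto
    show "continuous_on {x..x + 1} ?f"
      using assms by (intro continuous_at_imp_continuous_on ballI
          has_vector_derivative_continuous[OF f']) auto
    show "continuous_on {x..x + 1} ?phi"
      using assms by (intro continuous_at_imp_continuous_on ballI
          has_vector_derivative_continuous[OF phi']) auto
    show "norm (- s * powr_diff 0 (s + 1) (of_real t)) \<le> norm s * t powr (- Re s - 1)"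
      if "x < t" for t
      using that assms by (simp add: norm_mult norm_powr_real_powr)
  qed simp
  then show ?thesis
    by (simp add: norm_minus_commute algebra_simps)
qed

section \<open>Periodic sequences of mean zero\<close>

definition periodic_mean_zero :: "nat \<Rightarrow> (nat \<Rightarrow> complex) \<Rightarrow> bool" where
  "periodic_mean_zero q a \<longleftrightarrow> q > 0 \<and> (\<forall>n. a (n + q) = a n) \<and> (\<Sum>n<q. a n) = 0"

definition mean_partial_sum :: "nat \<Rightarrow> (nat \<Rightarrow> complex) \<Rightarrow> complex" where
  "mean_partial_sum q a = (\<Sum>n<q. \<Sum>m\<le>n. a m) / of_nat q"

text \<open>The antidifference of \<open>a\<close> whose constant of summation is chosen to have mean zero,
  so that the construction can be iterated.\<close>

definition antidifference :: "nat \<Rightarrow> (nat \<Rightarrow> complex) \<Rightarrow> nat \<Rightarrow> complex" where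
  "antidifference q a n = (\<Sum>m\<le>n. a m) - mean_partial_sum q a"

lemma periodic_mod:
  fixes a :: "nat \<Rightarrow> 'a"
  assumes "\<And>n. a (n + q) = a n"
  shows "a (n mod q) = a n"
proof -
  have "a (m + k * q) = a m" for m k
  proof (induction k)
    case (Suc k)
    then show ?case
      using assms[of "m + k * q"] by (simp add: add_ac)
  qed simp
  from this[of "n mod q" "n div q"] show ?thesis
    by simp
qed

text \<open>The first \<open>q\<close> terms cancel because the mean is zero; the remaining ones are
  a shift of the original sum.\<close>

lemma sum_atMost_periodic:
  assumes "periodic_mean_zero q a"
  shows "(\<Sum>m\<le>n + q. a m) = (\<Sum>m\<le>n. a m)"
proof -
  have "x \<in> (\<lambda>m. m + q) ` {..n}" if "x \<le> n + q" "\<not> x < q" for x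
    using that by (intro image_eqI[of _ _ "x - q"]) auto
  then have "{..n + q} = {..<q} \<union> (\<lambda>m. m + q) ` {..n}"
    by (intro set_eqI) auto
  then have "(\<Sum>m\<le>n + q. a m) = (\<Sum>m<q. a m) + (\<Sum>m\<in>(\<lambda>m. m + q) ` {..n}. a m)"
    by (simp only:, intro sum.union_disjoint) auto
  also have "\<dots> = (\<Sum>m\<le>n. a m)"
    using assms by (subst sum.reindex) (auto simp: periodic_mean_zero_def)
  finally show ?thesis .
qed

lemma periodic_mean_zero_antidifference:
  assumes "periodic_mean_zero q a"
  shows "periodic_mean_zero q (antidifference q a)"
proof -
  have q: "q > 0"
    using assms by (simp add: periodic_mean_zero_def)
  have "antidifference q a (n + q) = antidifference q a n" for n
    unfolding antidifference_def sum_atMost_periodic[OF assms] ..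
  moreover have "(\<Sum>n<q. antidifference q a n) = 0"
    using q by (simp add: antidifference_def sum_subtractf mean_partial_sum_def)
  ultimately show ?thesis
    using q by (simp add: periodic_mean_zero_def)
qed

lemma periodic_mean_zero_iterate:
  "periodic_mean_zero q a \<Longrightarrow> periodic_mean_zero q ((antidifference q ^^ K) a)"
  by (induction K) (simp_all add: periodic_mean_zero_antidifference)

lemma periodic_mean_zero_bounded:
  assumes "periodic_mean_zero q a"
  obtains B where "B \<ge> 0" "\<And>n. norm (a n) \<le> B"
proof
  have "norm (a n) \<le> (\<Sum>m<q. norm (a m))" for n
  proof -
    have "norm (a n) = norm (a (n mod q))"
      using assms periodic_mod[of a q n] by (auto simp: periodic_mean_zero_def)
    also have "\<dots> \<le> (\<Sum>m<q. norm (a m))"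
      using assms by (intro member_le_sum) (auto simp: periodic_mean_zero_def)
    finally show ?thesis .
  qed
  then show "\<And>n. norm (a n) \<le> (\<Sum>m<q. norm (a m))" .
qed (auto intro: sum_nonneg)

lemma norm_partial_sum_le:
  assumes "periodic_mean_zero q a" "\<And>n. norm (a n) \<le> 1"
  shows "norm (\<Sum>m\<le>n. a m) \<le> real q"
proof -
  have q: "q > 0"
    using assms by (simp add: periodic_mean_zero_def)
  have "norm (\<Sum>m\<le>n. a m) = norm (\<Sum>m\<le>n mod q. a m)"
    using periodic_mod[of "\<lambda>n. \<Sum>m\<le>n. a m" q n] sum_atMost_periodic[OF assms(1)] by simp
  also have "\<dots> \<le> real (card {..n mod q}) * 1"
    by (intro sum_norm_bound assms)
  also have "\<dots> \<le> real q"
    using mod_less_divisor[OF q, of n] by simp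
  finally show ?thesis .
qed

lemma norm_mean_partial_sum_le:
  assumes "periodic_mean_zero q a" "\<And>n. norm (a n) \<le> 1"
  shows "norm (mean_partial_sum q a) \<le> real q"
proof -
  have "norm (\<Sum>n<q. \<Sum>m\<le>n. a m) \<le> real (card {..<q}) * real q"
    by (intro sum_norm_bound norm_partial_sum_le assms)
  then show ?thesis
    using assms(1) by (simp add: mean_partial_sum_def periodic_mean_zero_def norm_divide field_simps)
qed

section \<open>Continuation of Dirichlet series with periodic coefficients\<close>

text \<open>The case expression is the antidifference at index \<open>N - 1\<close>; at
  \<open>N = 0\<close> the empty partial sum leaves only the constant of summation.\<close>

lemma sum_by_parts_antidifference:
  fixes u :: "nat \<Rightarrow> complex"
  shows "(\<Sum>n<N. a n * u n) = mean_partial_sum q a * u 0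
    + (\<Sum>n<N. antidifference q a n * (u n - u (Suc n)))
    + (case N of 0 \<Rightarrow> - mean_partial_sum q a | Suc M \<Rightarrow> antidifference q a M) * u N"
proof (induction N)
  case (Suc N)
  have aN: "a N = antidifference q a N
      - (case N of 0 \<Rightarrow> - mean_partial_sum q a | Suc M \<Rightarrow> antidifference q a M)"
    by (cases N) (simp_all add: antidifference_def)
  show ?case
    unfolding sum.lessThan_Suc Suc.IH aN by (simp add: ring_distribs)
qed simp

text \<open>The outcome of \<open>K\<close> summations by parts applied to the series with
  coefficient \<open>a n\<close> at \<open>Suc n\<close>. The finite sum collects the boundary terms
  at \<open>n = 0\<close>; for \<open>K = 0\<close> this is the Dirichlet series itself.\<close>

definition continuation :: "nat \<Rightarrow> (nat \<Rightarrow> complex) \<Rightarrow> nat \<Rightarrow> complex \<Rightarrow> complex" where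
  "continuation q a K s =
     (\<Sum>j<K. mean_partial_sum q ((antidifference q ^^ j) a) * powr_diff j s 1)
     + (\<Sum>n. (antidifference q ^^ K) a n * powr_diff K s (of_nat (Suc n)))"

lemma summable_Suc_powr:
  assumes "x < -1"
  shows "summable (\<lambda>n. real (Suc n) powr x)"
  using assms unfolding summable_Suc_iff[of "\<lambda>n. real n powr x"] summable_real_powr_iff .

lemma summable_powr_diff:
  assumes "\<And>n. norm (a n) \<le> B" "Re s > 1 - real K"
  shows "summable (\<lambda>n. norm (a n * powr_diff K s (of_nat (Suc n))))"
proof (rule summable_comparison_test')
  let ?P = "\<Prod>j<K. norm (s + of_nat j)"
  show "summable (\<lambda>n. B * (?P * real (Suc n) powr (- Re s - real K)))"
    using assms by (intro summable_mult summable_Suc_powr) auto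
  show "norm (norm (a n * powr_diff K s (of_nat (Suc n))))
      \<le> B * (?P * real (Suc n) powr (- Re s - real K))" for n
    using norm_powr_diff_le[of "real (Suc n)" s K] assms(2) order.trans[OF norm_ge_zero assms(1)]
    by (auto simp: norm_mult intro!: mult_mono assms(1))
qed

text \<open>One more summation by parts. The boundary term at infinity vanishes, being a bounded
  sequence times one that tends to 0.\<close>

lemma continuation_Suc:
  assumes a: "periodic_mean_zero q a" and s: "Re s > 1 - real K"
  shows "continuation q a K s = continuation q a (Suc K) s"
proof -
  define b where "b = (antidifference q ^^ K) a"
  define u where "u n = powr_diff K s (of_nat (Suc n))" for n
  have b: "periodic_mean_zero q b"
    unfolding b_def by (rule periodic_mean_zero_iterate[OF a])
  obtain B where B: "\<And>n. norm (b n) \<le> B"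
    using periodic_mean_zero_bounded[OF b] by metis
  obtain C where C: "C \<ge> 0" "\<And>n. norm (antidifference q b n) \<le> C"
    using periodic_mean_zero_bounded[OF periodic_mean_zero_antidifference[OF b]] by metis
  define D where "D = C + norm (mean_partial_sum q b)"
  have sum1: "(\<lambda>N. \<Sum>n<N. b n * u n) \<longlonglongrightarrow> (\<Sum>n. b n * u n)"
    unfolding u_def by (rule summable_LIMSEQ[OF summable_norm_cancel[OF summable_powr_diff[OF B s]]])
  have diff: "u n - u (Suc n) = powr_diff (Suc K) s (of_nat (Suc n))" for n
    by (simp only: u_def powr_diff.simps of_nat_Suc add.commute)
  have s': "Re s > 1 - real (Suc K)"
    using s by simp
  have sum2: "(\<lambda>N. \<Sum>n<N. antidifference q b n * (u n - u (Suc n)))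
      \<longlonglongrightarrow> (\<Sum>n. antidifference q b n * powr_diff (Suc K) s (of_nat (Suc n)))"
    unfolding diff
    by (rule summable_LIMSEQ[OF summable_norm_cancel[OF summable_powr_diff[OF C(2) s']]])
  \<comment> \<open>The summability lemma for the constant sequence 1 shows that \<open>u\<close> is
    summable, hence null.\<close>
  have u0: "u \<longlonglongrightarrow> 0"
    using summable_LIMSEQ_zero[OF summable_norm_cancel[OF summable_powr_diff[of "\<lambda>_. 1" 1 K s]]] s
    by (simp add: u_def[abs_def])
  have "(\<lambda>N. (case N of 0 \<Rightarrow> - mean_partial_sum q b | Suc M \<Rightarrow> antidifference q b M) * u N) \<longlonglongrightarrow> 0"
  proof (rule Lim_null_comparison)
    have "norm (case N of 0 \<Rightarrow> - mean_partial_sum q b | Suc M \<Rightarrow> antidifference q b M) \<le> D" for N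
      by (cases N) (auto simp: D_def C(1) intro!: order.trans[OF C(2)])
    then show "eventually (\<lambda>N. norm ((case N of 0 \<Rightarrow> - mean_partial_sum q b
        | Suc M \<Rightarrow> antidifference q b M) * u N) \<le> D * norm (u N)) sequentially"
      by (intro always_eventually allI) (simp add: norm_mult mult_right_mono)
    show "(\<lambda>N. D * norm (u N)) \<longlonglongrightarrow> 0"
      using tendsto_mult_right_zero[OF tendsto_norm_zero[OF u0]] .
  qed
  from tendsto_add[OF tendsto_add[OF tendsto_const[of "mean_partial_sum q b * u 0"] sum2] this,
      folded sum_by_parts_antidifference]
  have "(\<lambda>N. \<Sum>n<N. b n * u n) \<longlonglongrightarrow> mean_partial_sum q b * u 0
      + (\<Sum>n. antidifference q b n * powr_diff (Suc K) s (of_nat (Suc n))) + 0"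
    .
  from LIMSEQ_unique[OF sum1 this] show ?thesis
    by (simp add: continuation_def b_def u_def)
qed

lemma continuation_cong:
  assumes "periodic_mean_zero q a" "Re s > 1 - real K" "Re s > 1 - real K'"
  shows "continuation q a K s = continuation q a K' s"
proof -
  have *: "continuation q a K s = continuation q a (K + d) s" if "Re s > 1 - real K" for K d
  proof (induction d)
    case (Suc d)
    then show ?case
      using continuation_Suc[OF assms(1), of "K + d" s] that by simp
  qed simp
  show ?thesis
    using * assms(2,3) by (metis le_add_diff_inverse nat_le_linear)
qed

text \<open>The partial sums are entire in \<open>s\<close>, and the Weierstrass M-test gives
  uniform convergence on small closed discs.\<close>

lemma continuation_holomorphic:
  assumes "periodic_mean_zero q a"
  shows "continuation q a K holomorphic_on {s. Re s > 1 - real K}"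
proof -
  define b where "b = (antidifference q ^^ K) a"
  obtain B where B: "B \<ge> 0" "\<And>n. norm (b n) \<le> B"
    using periodic_mean_zero_bounded[OF periodic_mean_zero_iterate[OF assms, of K]]
    unfolding b_def by metis
  have "(\<lambda>s. \<Sum>n. b n * powr_diff K s (of_nat (Suc n))) holomorphic_on {s. Re s > 1 - real K}"
  proof (rule holomorphic_uniform_sequence)
    show "open {s. Re s > 1 - real K}"
      by (rule open_halfspace_Re_gt)
    show "(\<lambda>s. \<Sum>n<N. b n * powr_diff K s (of_nat (Suc n))) holomorphic_on {s. Re s > 1 - real K}"
      for N
      by (intro holomorphic_intros powr_diff_holomorphic) auto
    show "\<exists>r>0. cball z r \<subseteq> {s. Re s > 1 - real K} \<and>
        uniform_limit (cball z r) (\<lambda>N s. \<Sum>n<N. b n * powr_diff K s (of_nat (Suc n)))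
          (\<lambda>s. \<Sum>n. b n * powr_diff K s (of_nat (Suc n))) sequentially"
      if "z \<in> {s. Re s > 1 - real K}" for z
    proof -
      \<comment> \<open>Half the distance from \<open>z\<close> to the boundary line; the majorant
        is taken at the leftmost real part \<open>Re z - r\<close>, still to the right of that
        line.\<close>
      define r where "r = (Re z - (1 - real K)) / 2"
      have r: "r > 0" "Re z - r > 1 - real K"
        using that by (auto simp: r_def field_simps)
      have Re: "Re s \<ge> Re z - r" if "s \<in> cball z r" for s
        using that abs_Re_le_cmod[of "z - s"] by (auto simp: dist_norm)
      define P where "P = (\<Prod>j<K. norm z + r + real j)"
      have "norm (b n * powr_diff K s (of_nat (Suc n)))
          \<le> B * (P * real (Suc n) powr (- (Re z - r) - real K))" if "s \<in> cball z r" for n s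
      proof -
        have "norm (s + of_nat j) \<le> norm z + r + real j" for j
        proof -
          have "norm (s + of_nat j) \<le> norm z + norm (s - z) + real j"
            by (smt (verit) norm_of_nat norm_triangle_ineq norm_triangle_sub)
          then show ?thesis
            using that by (simp add: dist_norm norm_minus_commute)
        qed
        then have P: "(\<Prod>j<K. norm (s + of_nat j)) \<le> P"
          unfolding P_def by (intro prod_mono) auto
        have "norm (powr_diff K s (of_nat (Suc n)))
            \<le> (\<Prod>j<K. norm (s + of_nat j)) * real (Suc n) powr (- Re s - real K)"
          using norm_powr_diff_le[of "real (Suc n)" s K] Re[OF that] r by simp
        also have "\<dots> \<le> P * real (Suc n) powr (- (Re z - r) - real K)"
          using Re[OF that] r by (intro mult_mono P powr_mono) (auto simp: P_def intro!: prod_nonneg)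
        finally show ?thesis
          using B by (auto simp: norm_mult intro!: mult_mono)
      qed
      moreover have "summable (\<lambda>n. B * (P * real (Suc n) powr (- (Re z - r) - real K)))"
        using r by (intro summable_mult summable_Suc_powr) auto
      ultimately have "uniform_limit (cball z r) (\<lambda>N s. \<Sum>n<N. b n * powr_diff K s (of_nat (Suc n)))
          (\<lambda>s. \<Sum>n. b n * powr_diff K s (of_nat (Suc n))) sequentially"
        by (rule Weierstrass_m_test)
      moreover have "cball z r \<subseteq> {s. Re s > 1 - real K}"
        using Re r by fastforce
      ultimately show ?thesis
        using r by blast
    qed
  qed
  then show ?thesis
    unfolding continuation_def[abs_def] b_def
    by (intro holomorphic_intros powr_diff_holomorphic) auto
qed

lemma entire_continuation_exists:
  assumes a: "periodic_mean_zero q a"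
  obtains L where "L holomorphic_on UNIV"
    "\<And>K s. Re s > 1 - real K \<Longrightarrow> L s = continuation q a K s"
proof
  \<comment> \<open>The half-planes exhaust the plane and the continuations agree on overlaps. This
    choice has \<open>real K\<close> at least \<open>2 - Re s\<close>, so \<open>s\<close> lies in
    the half-plane for \<open>K\<close>.\<close>
  define L where "L s = continuation q a (nat \<lceil>2 - Re s\<rceil>) s" for s
  show L: "L s = continuation q a K s" if "Re s > 1 - real K" for K s
    unfolding L_def using that by (intro continuation_cong a) linarith+
  show "L holomorphic_on UNIV"
  proof (rule holomorphic_on_subset)
    have "L holomorphic_on (\<Union>K. {s. Re s > 1 - real K})"
    proof (rule holomorphic_on_UN_open)
      show "L holomorphic_on {s. Re s > 1 - real K}" for K
        using continuation_holomorphic[OF a, of K] L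
        by (subst holomorphic_cong[OF refl]) auto
    qed (auto intro: open_halfspace_Re_gt)
    then show "L holomorphic_on (\<Union>K. {s. Re s > 1 - real K})" .
    show "UNIV \<subseteq> (\<Union>K. {s. Re s > 1 - real K})"
    proof
      fix s :: complex
      have "s \<in> {z. Re z > 1 - real (nat \<lceil>2 - Re s\<rceil>)}"
        by (simp, linarith)
      then show "s \<in> (\<Union>K. {s. Re s > 1 - real K})"
        by blast
    qed
  qed
qed

text \<open>The boundary term is at most \<open>q\<close>, the antidifference at most
  \<open>2 * q\<close>, and the majorants \<open>?D\<close> telescope to
  \<open>norm s / Re s\<close>.\<close>

lemma norm_continuation_one_le:
  assumes a: "periodic_mean_zero q a" "\<And>n. norm (a n) \<le> 1" and s: "Re s > 0"
  shows "norm (continuation q a 1 s) \<le> real q * (1 + 2 * (norm s / Re s))"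
proof -
  let ?D = "\<lambda>n. norm s / Re s * (real (Suc n) powr (- Re s) - real (Suc (Suc n)) powr (- Re s))"
  have "norm (antidifference q a n) \<le> real q + real q" for n
    unfolding antidifference_def
    by (rule norm_triangle_le_diff[OF add_mono[OF norm_partial_sum_le[OF a] norm_mean_partial_sum_le[OF a]]])
  then have anti: "norm (antidifference q a n) \<le> 2 * real q" for n
    by simp
  have "(\<lambda>n. real (Suc n) powr (- Re s)) \<longlonglongrightarrow> 0"
    by (rule tendsto_neg_powr[OF _ filterlim_compose[OF filterlim_real_sequentially filterlim_Suc]])
      (use s in simp)
  from telescope_sums'[OF this]
  have "(\<lambda>n. real (Suc n) powr (- Re s) - real (Suc (Suc n)) powr (- Re s)) sums 1"
    by simp
  from sums_mult[OF this, of "norm s / Re s"] have D: "?D sums (norm s / Re s)"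
    by (simp only: mult_1_right)
  have bound: "norm (antidifference q a n * powr_diff 1 s (of_nat (Suc n))) \<le> 2 * real q * ?D n" for n
  proof -
    have "real (Suc n) + 1 = real (Suc (Suc n))"
      by simp
    then have "norm (powr_diff 1 s (of_nat (Suc n))) \<le> ?D n"
      using norm_powr_diff_one_le[OF s, of "real (Suc n)"] by (simp only: of_real_of_nat_eq)
    then show ?thesis
      unfolding norm_mult by (intro mult_mono anti) auto
  qed
  have "norm (\<Sum>n. antidifference q a n * powr_diff 1 s (of_nat (Suc n)))
      \<le> (\<Sum>n. 2 * real q * ?D n)"
    by (rule norm_suminf_le[OF bound]) (rule sums_summable[OF sums_mult[OF D]])
  also have "\<dots> = 2 * real q * (norm s / Re s)"
    by (rule sums_unique[OF sums_mult[OF D], symmetric])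
  finally have series: "norm (\<Sum>n. antidifference q a n * powr_diff 1 s (of_nat (Suc n)))
      \<le> 2 * real q * (norm s / Re s)" .
  have "norm (mean_partial_sum q a
      + (\<Sum>n. antidifference q a n * powr_diff 1 s (of_nat (Suc n))))
      \<le> real q + 2 * real q * (norm s / Re s)"
    by (rule norm_triangle_mono[OF norm_mean_partial_sum_le[OF a] series])
  then show ?thesis
    by (simp add: continuation_def ring_distribs mult_ac)
qed

section \<open>Dirichlet characters\<close>

lemma dirichlet_character_mod:
  assumes "dirichlet_character q chi"
  shows "chi (n mod int q) = chi n"
proof -
  have nat: "chi (m + int k * int q) = chi m" for m k
  proof (induction k)
    case (Suc k)
    have "chi (m + int (Suc k) * int q) = chi (m + int k * int q + int q)"
      by (simp add: algebra_simps)
    also have "\<dots> = chi (m + int k * int q)"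
      using assms by (simp add: dirichlet_character_def)
    finally show ?case
      using Suc by simp
  qed simp
  define d where "d = n div int q"
  have mod_eq: "n mod int q = n - d * int q"
    by (simp add: d_def minus_div_mult_eq_mod)
  show ?thesis
    \<comment> \<open>For \<open>d >= 0\<close> one climbs from the remainder to \<open>n\<close>,
      otherwise from \<open>n\<close> to the remainder.\<close>
    unfolding mod_eq using nat[of "n - d * int q" "nat d"] nat[of n "nat (- d)"]
    by (cases "d \<ge> 0") (auto simp: algebra_simps)
qed

text \<open>By periodicity the values of a character are bounded, hence so are their powers.\<close>

lemma norm_dirichlet_character_le_1:
  assumes "dirichlet_character q chi"
  shows "norm (chi n) \<le> 1"
proof (rule ccontr)
  assume "\<not> norm (chi n) \<le> 1"
  define B where "B = (\<Sum>m\<in>{0..<int q}. norm (chi m))"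
  have "norm (chi m) \<le> B" for m
  proof -
    have "norm (chi m) = norm (chi (m mod int q))"
      using dirichlet_character_mod[OF assms] by simp
    also have "\<dots> \<le> B"
      unfolding B_def using assms by (intro member_le_sum) (auto simp: dirichlet_character_def)
    finally show ?thesis .
  qed
  moreover have "chi (n ^ Suc k) = chi n ^ Suc k" for k
    using assms by (induction k) (auto simp: dirichlet_character_def)
  ultimately have B: "norm (chi n) ^ Suc k \<le> B" for k
    by (metis norm_power)
  obtain k where "B < norm (chi n) ^ k"
    using \<open>\<not> norm (chi n) \<le> 1\<close> real_arch_pow by (metis not_le)
  also have "\<dots> \<le> norm (chi n) ^ Suc k"
    using \<open>\<not> norm (chi n) \<le> 1\<close> by (intro power_increasing) auto
  finally show False
    using B[of k] by simp
qed

text \<open>Multiplication by a unit \<open>a\<close> with \<open>chi a\<close> different from 1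
  permutes the residues, so the sum equals \<open>chi a\<close> times itself.\<close>

lemma sum_dirichlet_character_eq_0:
  assumes chi: "dirichlet_character q chi" and "\<not> principal_character q chi"
  shows "(\<Sum>n\<in>{0..<int q}. chi n) = 0"
proof -
  obtain a where a: "coprime a (int q)" "chi a \<noteq> 1"
    using assms by (auto simp: principal_character_def)
  have q: "int q > 0"
    using chi by (simp add: dirichlet_character_def)
  let ?g = "\<lambda>n. (a * n) mod int q"
  have "inj_on ?g {0..<int q}"
  proof (rule inj_onI)
    fix m n assume mn: "m \<in> {0..<int q}" "n \<in> {0..<int q}" "?g m = ?g n"
    then have "int q dvd a * (m - n)"
      by (simp add: mod_eq_dvd_iff right_diff_distrib)
    then have "int q dvd m - n"
      using a by (simp add: coprime_commute coprime_dvd_mult_right_iff)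
    then have "m mod int q = n mod int q"
      by (simp add: mod_eq_dvd_iff)
    then show "m = n"
      using mn by simp
  qed
  moreover from this have "?g ` {0..<int q} = {0..<int q}"
    using q by (intro endo_inj_surj) auto
  ultimately have "(\<Sum>n\<in>{0..<int q}. chi n) = (\<Sum>n\<in>{0..<int q}. chi (?g n))"
    by (metis (no_types, lifting) sum.reindex_cong)
  also have "\<dots> = chi a * (\<Sum>n\<in>{0..<int q}. chi n)"
    using chi dirichlet_character_mod[OF chi]
    by (simp add: sum_distrib_left dirichlet_character_def)
  finally show ?thesis
    using a by (simp add: algebra_simps flip: mult_1_left)
qed

lemma periodic_mean_zero_dirichlet_character:
  assumes chi: "dirichlet_character q chi" and "\<not> principal_character q chi"
  shows "periodic_mean_zero q (\<lambda>n. chi (int (Suc n)))"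
proof -
  have q: "q > 0" and per: "chi (n + int q) = chi n" for n
    using chi by (auto simp: dirichlet_character_def)
  have "(\<Sum>n<q. chi (int n)) = (\<Sum>n\<in>{0..<int q}. chi n)"
    by (rule sum.reindex_bij_witness[of _ nat int]) auto
  then have "(\<Sum>n<q. chi (int n)) = 0"
    using sum_dirichlet_character_eq_0[OF assms] by simp
  \<comment> \<open>The shifted sequence runs over 1, ..., \<open>q\<close> instead of 0, ...,
    \<open>q - 1\<close>; the exchanged values \<open>chi 0\<close> and \<open>chi (int q)\<close>
    agree.\<close>
  moreover have "(\<Sum>n<Suc q. chi (int n)) = chi 0 + (\<Sum>n<q. chi (int (Suc n)))"
    by (subst sum.lessThan_Suc_shift) simp
  moreover have "chi (int q) = chi 0"
    using per[of 0] by simp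
  moreover have "chi (int (Suc (n + q))) = chi (int (Suc n))" for n
    using per[of "int (Suc n)"] by (simp add: algebra_simps)
  ultimately show ?thesis
    using q by (auto simp: periodic_mean_zero_def)
qed

text \<open>A principal character is induced by the constant character modulo 1.\<close>

lemma primitive_character_not_principal:
  assumes "primitive_character q chi" "q > 1"
  shows "\<not> principal_character q chi"
proof
  assume "principal_character q chi"
  then have "induced_by q chi 1 (\<lambda>_. 1)"
    by (auto simp: induced_by_def principal_character_def dirichlet_character_def)
  then show False
    using assms by (auto simp: primitive_character_def)
qed

text \<open>Identifies the definite description with any entire function having the right series;
  uniqueness is the identity theorem from the half-plane \<open>Re s > 1\<close>.\<close>

lemma dirichlet_L_eqI:
  assumes "\<not> principal_character q chi" "L holomorphic_on UNIV"
    and "\<And>s. Re s > 1 \<Longrightarrow> (\<lambda>n. chi (int (Suc n)) / of_nat (Suc n) powr s) sums L s"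
  shows "dirichlet_L q chi = L"
  unfolding dirichlet_L_def
proof (rule the_equality, goal_cases)
  case 1
  then show ?case
    using assms by simp
next
  case (2 L')
  have "L' s = L s" for s
  proof (rule analytic_continuation_open[of "{s. Re s > 1}" UNIV L' L])
    show "{s. Re s > 1} \<noteq> {}"
      by (auto intro: exI[of _ 2])
    show "L' z = L z" if "z \<in> {s. Re s > 1}" for z
      using 2 assms that sums_unique2 by blast
  qed (use 2 assms in \<open>auto intro: open_halfspace_Re_gt\<close>)
  then show ?case
    by auto
qed

lemma dirichlet_L_nonprincipal:
  assumes chi: "dirichlet_character q chi" and "\<not> principal_character q chi"
  shows "dirichlet_L q chi holomorphic_on UNIV"
    and "Re s > 0 \<Longrightarrow> norm (dirichlet_L q chi s) \<le> real q * (1 + 2 * (norm s / Re s))"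
proof -
  define a where "a n = chi (int (Suc n))" for n
  have a: "periodic_mean_zero q a"
    unfolding a_def by (rule periodic_mean_zero_dirichlet_character[OF assms])
  have a1: "norm (a n) \<le> 1" for n
    unfolding a_def by (rule norm_dirichlet_character_le_1[OF chi])
  obtain L where L: "L holomorphic_on UNIV" "\<And>K s. Re s > 1 - real K \<Longrightarrow> L s = continuation q a K s"
    using entire_continuation_exists[OF a] by metis
  have "dirichlet_L q chi = L"
  proof (rule dirichlet_L_eqI[OF assms(2) L(1)])
    fix s :: complex assume s: "Re s > 1"
    \<comment> \<open>The case \<open>K = 0\<close> recovers the series; the growth bound below uses
      \<open>K = 1\<close>.\<close>
    have "(\<lambda>n. a n * powr_diff 0 s (of_nat (Suc n))) sums L s"
      using summable_powr_diff[OF a1, of 0 s] L(2)[of 0 s] s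
      by (simp add: continuation_def summable_norm_cancel summable_sums)
    then show "(\<lambda>n. chi (int (Suc n)) / of_nat (Suc n) powr s) sums L s"
      by (simp add: a_def powr_minus_divide)
  qed
  moreover have "norm (L s) \<le> real q * (1 + 2 * (norm s / Re s))" if "Re s > 0"
    using norm_continuation_one_le[OF a a1 that] L(2)[of 1 s] that by simp
  ultimately show "dirichlet_L q chi holomorphic_on UNIV"
    and "Re s > 0 \<Longrightarrow> norm (dirichlet_L q chi s) \<le> real q * (1 + 2 * (norm s / Re s))"
    using L(1) by simp_all
qed

section \<open>The Taylor remainder\<close>

text \<open>Without a pole the Laurent expansion is the Taylor expansion, and the two factors (-1)^n
  cancel.\<close>

lemma laurent_stieltjes_eq_deriv:
  assumes "dirichlet_L q chi analytic_on {1}"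
  shows "(-1) ^ n * laurent_stieltjes q chi n = (deriv ^^ n) (dirichlet_L q chi) 1"
proof -
  have "laurent_expansion (dirichlet_L q chi) 1 = fps_to_fls (fps_expansion (dirichlet_L q chi) 1)"
    by (intro laurent_expansion_eqI has_laurent_expansion_fps
        analytic_at_imp_has_fps_expansion assms)
  then show ?thesis
    by (simp add: laurent_stieltjes_def fps_expansion_def flip: power_mult_distrib mult.assoc)
qed

text \<open>Cauchy's inequality bounds the \<open>n\<close>-th term by
  \<open>M * (r / R) ^ n\<close>; the tail from \<open>m\<close> on is geometric.\<close>

lemma taylor_remainder_le:
  assumes f: "f holomorphic_on cball z R"
    and M: "\<And>w. norm (w - z) = R \<Longrightarrow> norm (f w) \<le> M"
    and r: "norm (w - z) \<le> r" "r < R"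
  shows "norm (f w - (\<Sum>n<m. (deriv ^^ n) f z / fact n * (w - z) ^ n))
    \<le> M * (r / R) ^ m / (1 - r / R)"
proof -
  define c where "c n = (deriv ^^ n) f z / fact n * (w - z) ^ n" for n
  have R: "0 \<le> r" "0 < R" "r / R < 1"
    using r norm_ge_zero[of "w - z"] by (auto intro: order.trans simp del: norm_ge_zero)
  have hol: "f holomorphic_on ball z R"
    using f ball_subset_cball by (rule holomorphic_on_subset)
  have "w \<in> ball z R"
    using r by (simp add: dist_norm norm_minus_commute)
  from holomorphic_power_series[OF hol this] have c: "c sums f w"
    by (simp only: c_def[abs_def])
  have bound: "norm (c n) \<le> M * (r / R) ^ n" for n
  proof -
    have "norm ((deriv ^^ n) f z) \<le> fact n * M / R ^ n"
      using M R f by (intro Cauchy_inequality hol holomorphic_on_imp_continuous_on)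
        (auto simp: norm_minus_commute)
    then have cauchy: "norm ((deriv ^^ n) f z) / fact n \<le> M / R ^ n"
      by (simp add: field_simps)
    have "norm (c n) = norm ((deriv ^^ n) f z) / fact n * norm (w - z) ^ n"
      by (simp add: c_def norm_mult norm_divide norm_power)
    also have "\<dots> \<le> M / R ^ n * r ^ n"
      \<comment> \<open>Nonnegativity of \<open>M / R ^ n\<close>, which \<open>mult_mono\<close>
        asks for, is read off from \<open>cauchy\<close>.\<close>
      using r by (intro mult_mono cauchy power_mono order.trans[OF _ cauchy]) auto
    finally show ?thesis
      by (simp add: power_divide)
  qed
  have geom: "(\<lambda>n. M * (r / R) ^ m * (r / R) ^ n) sums (M * (r / R) ^ m * (1 / (1 - r / R)))"
    using R by (intro sums_mult geometric_sums) auto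
  have "f w - (\<Sum>n<m. c n) = (\<Sum>n. c (n + m))"
    using sums_split_initial_segment[OF c, of m] by (simp add: sums_iff)
  also have "norm \<dots> \<le> (\<Sum>n. M * (r / R) ^ m * (r / R) ^ n)"
  proof (rule norm_suminf_le)
    show "norm (c (n + m)) \<le> M * (r / R) ^ m * (r / R) ^ n" for n
      using bound[of "n + m"] by (simp only: power_add mult.assoc mult.commute[of "(r / R) ^ n"])
    show "summable (\<lambda>n. M * (r / R) ^ m * (r / R) ^ n)"
      using geom by (rule sums_summable)
  qed
  also have "\<dots> = M * (r / R) ^ m / (1 - r / R)"
    using geom by (simp add: sums_iff)
  finally show ?thesis
    by (simp add: c_def)
qed

lemma exp_minus_le:
  fixes x :: real
  assumes "x \<ge> 0"
  shows "exp (- x) \<le> 1 / (1 + x)"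
  using exp_ge_add_one_self[of x] assms
  by (simp add: exp_minus inverse_eq_divide frac_le)

text \<open>Tangents from the origin to the circle of radius \<open>R\<close> about 1 give
  \<open>norm s / Re s \<le> 1 / sqrt (1 - R\<^sup>2)\<close>, and \<open>R\<^sup>2 = exp (- 1 / 4) \<le> 4 / 5\<close>.\<close>

lemma norm_le_Re_on_circle:
  assumes "norm (s - 1) = exp (- 1 / 8)"
  shows "Re s > 0" "norm s \<le> 9 / 4 * Re s"
proof -
  have "norm (s - 1) < 1"
    using assms by simp
  from order.strict_trans1[OF abs_Re_le_cmod this] show pos: "Re s > 0"
    by (simp add: abs_less_iff)
  have "exp (- 1 / 4 :: real) \<le> 4 / 5"
    using exp_minus_le[of "1 / 4"] by simp
  moreover have "exp (- 1 / 8 :: real) ^ 2 = exp (- 1 / 4)"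
    by (simp add: power2_eq_square flip: exp_add)
  ultimately have "norm (s - 1) ^ 2 \<le> 4 / 5"
    using assms by simp
  then have "norm s ^ 2 \<le> 2 * Re s - 1 / 5"
    unfolding cmod_power2 by (simp add: power2_eq_square algebra_simps)
  \<comment> \<open>With x = \<open>Re s\<close>, the difference 5 x^2 - 2 x + 1/5 equals (5 x -
    1)^2 / 5. The next step uses that 9/4 exceeds the square root of 5.\<close>
  also have "\<dots> \<le> 5 * Re s ^ 2"
    using zero_le_power2[of "5 * Re s - 1"] by (simp add: power2_eq_square algebra_simps)
  also have "\<dots> \<le> (9 / 4 * Re s) ^ 2"
    unfolding power_mult_distrib by (intro mult_right_mono) (auto simp: power2_eq_square)
  finally show "norm s \<le> 9 / 4 * Re s"
    by (rule power2_le_imp_le) (use pos in simp)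
qed

theorem mainTheorem1:
  fixes q :: nat and chi :: "int \<Rightarrow> complex" and N :: real and s :: complex
  assumes "q \<ge> 150"
    and "primitive_character q chi"
    and "N = 4 * ln (real q)"
    and "norm (s - 1) \<le> exp (-1)"
  shows "norm (dirichlet_L q chi s -
           (\<Sum>n\<in>{n::nat. real n \<le> N}.
              (-1) ^ n * laurent_stieltjes q chi n / fact n * (s - 1) ^ n))
         \<le> 32.3 / real q powr 2.5"
proof -
  let ?L = "dirichlet_L q chi"
  \<comment> \<open>Then \<open>exp (- 1) / R = exp (- 7 / 8)\<close>, and 4 * 7/8 = 7/2; the factor
    \<open>q\<close> from the bound on the circle leaves the exponent -5/2.\<close>
  define R where "R = exp (- 1 / 8 :: real)"
  \<comment> \<open>The number of integers in the range of summation; rounding up past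
    \<open>N\<close> gives \<open>N <= real m\<close>, the direction that \<open>pow\<close>
    needs.\<close>
  define m where "m = Suc (nat \<lfloor>N\<rfloor>)"
  have chi: "dirichlet_character q chi" "\<not> principal_character q chi"
    using assms primitive_character_not_principal[of q chi]
    by (auto simp: primitive_character_def)
  note L = dirichlet_L_nonprincipal[OF chi]
  have q: "real q > 0"
    using assms by simp
  have "N \<ge> 0"
    using assms by simp
  then have m: "{n. real n \<le> N} = {..<m}" "N \<le> real m"
    unfolding m_def by (auto simp: less_Suc_eq_le le_nat_iff le_floor_iff) linarith
  have M: "norm (?L w) \<le> 11 / 2 * real q" if "norm (w - 1) = R" for w
  proof -
    note w = norm_le_Re_on_circle[OF that[unfolded R_def]]
    have "norm (?L w) \<le> real q * (1 + 2 * (norm w / Re w))"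
      using L(2)[OF w(1)] .
    also have "\<dots> \<le> real q * (1 + 2 * (9 / 4))"
      using w by (intro mult_left_mono add_left_mono) (auto simp: field_simps)
    finally show ?thesis
      by simp
  qed
  have ratio_le: "exp (- 7 / 8 :: real) \<le> 8 / 15"
    using exp_minus_le[of "7 / 8"] by simp
  have ratio: "exp (- 1) / R = exp (- 7 / 8)"
    by (simp add: R_def flip: exp_diff)
  have "exp (- 7 / 8 :: real) ^ m = exp (- (7 / 8) * real m)"
    by (simp flip: exp_of_nat_mult)
  also have "\<dots> \<le> exp (- (7 / 8) * N)"
    using m by simp
  also have "\<dots> = real q powr (- 7 / 2)"
    using q assms by (simp add: powr_def)
  finally have pow: "exp (- 7 / 8 :: real) ^ m \<le> real q powr (- 7 / 2)" .
  have "norm (?L s - (\<Sum>n<m. (deriv ^^ n) ?L 1 / fact n * (s - 1) ^ n))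
      \<le> 11 / 2 * real q * (exp (- 1) / R) ^ m / (1 - exp (- 1) / R)"
    using assms M by (intro taylor_remainder_le holomorphic_on_subset[OF L(1)]) (auto simp: R_def)
  \<comment> \<open>The denominator is at least 1 - 8/15 = 7/15 by \<open>ratio_le\<close>.\<close>
  also have "\<dots> \<le> 11 / 2 * real q * real q powr (- 7 / 2) / (7 / 15)"
    unfolding ratio using pow ratio_le by (intro frac_le mult_left_mono) auto
  also have "\<dots> = 165 / 14 * real q powr (1 + - 7 / 2)"
    using q unfolding powr_add by simp
  \<comment> \<open>The constant obtained, 165/14, is below 12.\<close>
  also have "\<dots> \<le> 32.3 * real q powr (1 + - 7 / 2)"
    by (intro mult_right_mono) auto
  also have "\<dots> = 32.3 / real q powr 2.5"
    by (simp add: powr_minus_divide)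
  also have "(\<Sum>n<m. (deriv ^^ n) ?L 1 / fact n * (s - 1) ^ n) =
      (\<Sum>n\<in>{n::nat. real n \<le> N}. (-1) ^ n * laurent_stieltjes q chi n / fact n * (s - 1) ^ n)"
    unfolding m using L(1)
    by (subst laurent_stieltjes_eq_deriv) (auto simp: analytic_on_holomorphic)
  finally show ?thesis .
qed

end
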